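(* Let $m$, $t$ and $r\ge 3$ be positive integers satisfying $m \ge \binom{t-1}{r} + \binom{t-2}{r-1}+1$. Let $G$ be an $r$-graph on the vertex set $[t]$ with $m$ edges. If $[t-1]^{(r)}\subseteq G$, then $G$ is dense.
   Context: For a finite set $V$, $V^{(r)}$ denotes the family of all $r$-element subsets of $V$; $[n]=\{1,\dots,n\}$. An $r$-graph ($r$-uniform graph) $G$ consists of a finite vertex set $V(G)$ and an edge set $E(G)\subseteq V(G)^{(r)}$. $H$ is a subgraph of $G$ ($H\subseteq G$) if $V(H)\subseteq V(G)$ and $E(H)\subseteq E(G)$. $[n]^{(r)}$ also denotes the complete $r$-graph on the vertex set $[n]$. For an $r$-graph $G$ with vertex set $[n]$ and $\vec x=(x_1,\dots,x_n)\in\mathbb R^n$, let $\lambda(G,\vec x)=\sum_{e\in E(G)}\prod_{i\in e}x_i$. The Lagrangian of $G$ is $\lambda(G)=\max\{\lambda(G,\vec x): \sum_{i=1}^n x_i=1,\ x_i\ge 0 \text{ for all } i\}$ (and analogously for an arbitrary finite vertex set). An $r$-graph $G$ is dense if every proper subgraph $G'$ of $G$ satisfies $\lambda(G')<\lambda(G)$ (equivalently, no optimum weighting of $G$ has a zero coordinate). *)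

theory Defs
  imports "HOL-Analysis.Analysis" "HOL-Library.Ramsey"
begin

datatype 'a hypergraph = Hypergraph (verts: "'a set") (edges: "'a set set")

definition r_graph :: "nat \<Rightarrow> 'a hypergraph \<Rightarrow> bool" where
  "r_graph r G \<longleftrightarrow> finite (verts G) \<and> edges G \<subseteq> [verts G]\<^bsup>r\<^esup>"

definition complete_r_graph :: "nat \<Rightarrow> 'a set \<Rightarrow> 'a hypergraph" where
  "complete_r_graph r V = Hypergraph V ([V]\<^bsup>r\<^esup>)"

definition subgraph :: "'a hypergraph \<Rightarrow> 'a hypergraph \<Rightarrow> bool" where
  "subgraph H G \<longleftrightarrow> verts H \<subseteq> verts G \<and> edges H \<subseteq> edges G"

definition lagrangian_poly :: "'a hypergraph \<Rightarrow> ('a \<Rightarrow> real) \<Rightarrow> real" where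
  "lagrangian_poly G x = (\<Sum>e\<in>edges G. \<Prod>i\<in>e. x i)"

text \<open>Only the values of a weighting on the vertex set matter; values elsewhere are arbitrary.\<close>

definition weightings :: "'a set \<Rightarrow> ('a \<Rightarrow> real) set" where
  "weightings V = {x. (\<Sum>i\<in>V. x i) = 1 \<and> (\<forall>i\<in>V. 0 \<le> x i)}"

text \<open>
  The supremum is a maximum for every \<open>r\<close>-graph with at least one vertex, see
  \<open>lagrangian_attained\<close> below. The graph without vertices has no weightings;
  its Lagrangian is taken to be 0.
\<close>

definition lagrangian :: "'a hypergraph \<Rightarrow> real" where
  "lagrangian G = (if verts G = {} then 0
     else (SUP x\<in>weightings (verts G). lagrangian_poly G x))"

definition dense_r_graph :: "nat \<Rightarrow> 'a hypergraph \<Rightarrow> bool" where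
  "dense_r_graph r G \<longleftrightarrow> r_graph r G \<and>
     (\<forall>H. r_graph r H \<and> subgraph H G \<and> H \<noteq> G \<longrightarrow> lagrangian H < lagrangian G)"

lemma lagrangian_attained:
  assumes G: "r_graph r G" and ne: "verts G \<noteq> {}"
  shows "\<exists>x\<in>weightings (verts G). lagrangian_poly G x = lagrangian G \<and>
           (\<forall>y\<in>weightings (verts G). lagrangian_poly G y \<le> lagrangian G)"
proof -
  define V where "V = verts G"
  have fin: "finite V" using G by (simp add: r_graph_def V_def)
  have sub: "e \<subseteq> V" if "e \<in> edges G" for e
    using G that by (auto simp: r_graph_def nsets_def V_def)
  define K :: "('a \<Rightarrow> real) set"
    where "K = PiE UNIV (\<lambda>i. if i \<in> V then {0..1} else {0})"
  have "compactin (product_topology (\<lambda>i. euclidean) UNIV) K"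
    unfolding K_def by (subst compactin_PiE) auto
  then have "compact K"
    by (simp add: euclidean_product_topology)
  moreover have "closed {x :: 'a \<Rightarrow> real. (\<Sum>i\<in>V. x i) = 1}"
    by (intro closed_Collect_eq continuous_intros continuous_on_product_coordinates)
  ultimately have comp: "compact (K \<inter> {x. (\<Sum>i\<in>V. x i) = 1})"
    by (rule compact_Int_closed)
  have cont: "continuous_on (K \<inter> {x. (\<Sum>i\<in>V. x i) = 1}) (lagrangian_poly G)"
    unfolding lagrangian_poly_def
    by (rule continuous_on_subset[of UNIV])
       (auto intro!: continuous_intros continuous_on_product_coordinates)
  define cut where "cut x = (\<lambda>i. if i \<in> V then x i else 0)" for x :: "'a \<Rightarrow> real"
  have cut: "cut x \<in> K \<inter> {x. (\<Sum>i\<in>V. x i) = 1}" if "x \<in> weightings V" for x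
  proof -
    have "x i \<le> 1" if "i \<in> V" for i
      using \<open>x \<in> weightings V\<close> member_le_sum[of i V x] that fin
      by (auto simp: weightings_def)
    then show ?thesis
      using that by (auto simp: weightings_def cut_def K_def)
  qed
  have poly_cut: "lagrangian_poly G (cut x) = lagrangian_poly G x" for x
    unfolding lagrangian_poly_def cut_def using sub
    by (intro sum.cong prod.cong) auto
  have W: "x \<in> weightings V" if "x \<in> K \<inter> {x. (\<Sum>i\<in>V. x i) = 1}" for x
  proof -
    have "x i \<in> (if i \<in> V then {0..1} else {0})" for i
      using that PiE_mem[of x UNIV _ i] unfolding K_def by blast
    then have "0 \<le> x i" if "i \<in> V" for i
      using that by (metis atLeastAtMost_iff)
    then show ?thesis
      using that by (simp add: weightings_def)
  qed
  obtain v where "v \<in> V" using ne by (auto simp: V_def)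
  then have "(\<lambda>i. if i = v then 1 else 0) \<in> weightings V"
    using fin by (auto simp: weightings_def)
  then have "K \<inter> {x. (\<Sum>i\<in>V. x i) = 1} \<noteq> {}" using cut by blast
  from continuous_attains_sup[OF comp this cont]
  obtain x where x: "x \<in> K \<inter> {x. (\<Sum>i\<in>V. x i) = 1}"
    and mx: "\<And>y. y \<in> K \<inter> {x. (\<Sum>i\<in>V. x i) = 1} \<Longrightarrow> lagrangian_poly G y \<le> lagrangian_poly G x"
    by blast
  have mx': "lagrangian_poly G y \<le> lagrangian_poly G x" if "y \<in> weightings V" for y
    using mx[OF cut[OF that]] by (simp add: poly_cut)
  have "lagrangian G = lagrangian_poly G x"
    unfolding lagrangian_def using ne W[OF x] mx'
    by (auto simp: V_def intro!: cSup_eq_maximum)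
  then show ?thesis using W[OF x] mx' by (auto simp: V_def)
qed

end

theory Submission
  imports Defs
begin

text \<open>
  A weighting of \<open>G\<close> that vanishes at some vertex only sees the edges inside a set of
  \<open>n = t - 1\<close> vertices, so by Maclaurin's inequality (\<open>maclaurin_complete\<close>) its value is at most
  \<open>(n choose r) / n ^ r\<close>, the value of the complete \<open>r\<close>-graph at the uniform weighting.
  It therefore suffices that \<open>G\<close> exceeds this number (\<open>lagrangian_gt_complete\<close>): then every
  optimum weighting is positive on all vertices, and losing a vertex or an edge costs something
  (\<open>dense_if_optimum_positive\<close>).

  To exceed it, start from the uniform weighting of the \<open>n\<close> vertices that span a complete
  \<open>r\<close>-graph, and move a little weight to the last vertex. At the uniform weighting the partial
  derivative in the direction of each old vertex is \<open>((n - 1) choose (r - 1)) / n ^ (r - 1)\<close>,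
  whereas for the new vertex it is its degree divided by \<open>n ^ (r - 1)\<close>. The bound on the number
  of edges says exactly that this degree is larger than \<open>(n - 1) choose (r - 1)\<close>, so the value
  increases to first order.
\<close>

section \<open>Maclaurin's inequality for complete graphs\<close>

lemma lagrangian_poly_complete_insert:
  assumes "finite V" "a \<notin> V"
  shows "lagrangian_poly (complete_r_graph (Suc k) (insert a V)) x =
    lagrangian_poly (complete_r_graph (Suc k) V) x
      + x a * lagrangian_poly (complete_r_graph k V) x"
proof -
  have split: "[insert a V]\<^bsup>Suc k\<^esup> = [V]\<^bsup>Suc k\<^esup> \<union> insert a ` [V]\<^bsup>k\<^esup>"
  proof (intro set_eqI iffI)
    fix e assume e: "e \<in> [insert a V]\<^bsup>Suc k\<^esup>"
    show "e \<in> [V]\<^bsup>Suc k\<^esup> \<union> insert a ` [V]\<^bsup>k\<^esup>"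
    proof (cases "a \<in> e")
      case True
      then have "e = insert a (e - {a})" "e - {a} \<in> [V]\<^bsup>k\<^esup>"
        using e by (auto simp: nsets_def)
      then show ?thesis by blast
    next
      case False
      then show ?thesis using e by (auto simp: nsets_def)
    qed
  qed (use assms in \<open>auto simp: nsets_def card_insert_if\<close>)
  have disj: "[V]\<^bsup>Suc k\<^esup> \<inter> insert a ` [V]\<^bsup>k\<^esup> = {}"
    using assms by (auto simp: nsets_def)
  have inj: "inj_on (insert a) ([V]\<^bsup>k\<^esup>)"
    using assms by (auto simp: inj_on_def nsets_def)
  have "(\<Sum>e\<in>insert a ` [V]\<^bsup>k\<^esup>. \<Prod>i\<in>e. x i) = (\<Sum>e\<in>[V]\<^bsup>k\<^esup>. x a * (\<Prod>i\<in>e. x i))"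
    unfolding sum.reindex[OF inj] using assms
    by (intro sum.cong refl) (auto simp: nsets_def intro!: prod.insert)
  then show ?thesis
    using assms disj unfolding lagrangian_poly_def complete_r_graph_def
    by (simp add: split sum.union_disjoint finite_imp_finite_nsets sum_distrib_left)
qed

text \<open>The graph of a convex function lies above its tangent at \<open>u\<close>.\<close>

lemma power_tangent_le:
  fixes u v :: real
  assumes "0 \<le> u" "0 \<le> v"
  shows "u ^ k * (Suc k * v - k * u) \<le> v ^ Suc k"
proof (induction k)
  case 0
  then show ?case by simp
next
  case (Suc k)
  have "0 \<le> u ^ k * (v - u)\<^sup>2 * (k + 1)"
    using assms by simp
  also have "\<dots> = v * (u ^ k * (Suc k * v - k * u)) - u ^ Suc k * (Suc (Suc k) * v - Suc k * u)"
    by (simp add: algebra_simps power2_eq_square)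
  finally show ?case
    using mult_left_mono[OF Suc.IH assms(2)] by simp
qed

text \<open>
  Adding a vertex \<open>a\<close> to \<open>n\<close> vertices of mean weight \<open>u\<close> gives, by induction, the bound
  \<open>(n choose r) * u ^ r + (n choose (r - 1)) * x a * u ^ (r - 1)\<close>. This is the tangent at \<open>u\<close> to
  \<open>((n + 1) choose r) * v ^ r\<close>, evaluated at the new mean \<open>v\<close>, so convexity gives the claim.
\<close>

lemma maclaurin_complete:
  assumes "finite V" "\<forall>i\<in>V. 0 \<le> x i"
  shows "lagrangian_poly (complete_r_graph r V) x \<le> (card V choose r) * (sum x V / card V) ^ r"
  using assms
proof (induction V arbitrary: r rule: finite_induct)
  case empty
  have "[{}]\<^bsup>r\<^esup> = (if r = 0 then {{}} else {} :: 'a set set)"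
    by (auto simp: nsets_def)
  then show ?case
    by (simp add: lagrangian_poly_def complete_r_graph_def)
next
  case (insert a V)
  define n where "n = card V"
  define u where "u = sum x V / n"
  define v where "v = sum x (insert a V) / Suc n"
  have "0 \<le> x a" "0 \<le> sum x V" using insert by (auto intro: sum_nonneg)
  then have uv: "0 \<le> u" "0 \<le> v"
    using insert by (auto simp: u_def v_def)
  have nu: "n * u = sum x V"
    using insert by (auto simp: u_def n_def)
  have mean: "Suc n * v = x a + n * u"
    using insert by (simp add: v_def nu)
  have card: "card (insert a V) = Suc n"
    using insert by (simp add: n_def)
  have "lagrangian_poly (complete_r_graph r (insert a V)) x \<le> (Suc n choose r) * v ^ r"
  proof (cases r)
    case 0
    have "[insert a V]\<^bsup>0\<^esup> = {{}}"
      by (auto simp: nsets_def)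
    then show ?thesis
      by (simp add: 0 lagrangian_poly_def complete_r_graph_def)
  next
    case (Suc k)
    have IH: "lagrangian_poly (complete_r_graph j V) x \<le> (n choose j) * u ^ j" for j
      using insert by (simp add: n_def u_def)
    have 1: "Suc k * real (Suc n choose Suc k) = Suc n * real (n choose k)"
      by (metis Suc_times_binomial_eq of_nat_mult mult.commute)
    have 2: "real (n choose Suc k) = real (Suc n choose Suc k) - real (n choose k)"
      by simp
    have "lagrangian_poly (complete_r_graph r (insert a V)) x
        \<le> (n choose Suc k) * u ^ Suc k + x a * ((n choose k) * u ^ k)"
      using insert \<open>0 \<le> x a\<close> IH
      by (simp add: Suc lagrangian_poly_complete_insert add_mono mult_left_mono
               del: power_Suc)
    also have "\<dots> = u ^ k * ((n choose Suc k) * u + (n choose k) * x a)"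
      by (simp add: algebra_simps)
    also have "(n choose Suc k) * u + (n choose k) * x a
        = (Suc n choose Suc k) * (Suc k * v - k * u)"
    proof -
      have xa: "x a = Suc n * v - n * u" using mean by simp
      have "(n choose Suc k) * u + (n choose k) * x a
          = (Suc n choose Suc k) * u + (Suc n * real (n choose k)) * (v - u)"
        unfolding xa 2 by (simp add: algebra_simps)
      also have "\<dots> = (Suc n choose Suc k) * (Suc k * v - k * u)"
        unfolding 1[symmetric] by (simp add: algebra_simps del: binomial_Suc_Suc)
      finally show ?thesis .
    qed
    also have "u ^ k * ((Suc n choose Suc k) * (Suc k * v - k * u))
        = (Suc n choose Suc k) * (u ^ k * (Suc k * v - k * u))"
      by (simp add: mult_ac)
    also have "\<dots> \<le> (Suc n choose Suc k) * v ^ Suc k"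
      by (intro mult_left_mono power_tangent_le uv) simp
    finally show ?thesis by (simp add: Suc)
  qed
  then show ?case by (simp add: card v_def)
qed

section \<open>Dense graphs and positive optimum weightings\<close>

lemma lagrangian_poly_le_lagrangian:
  assumes "r_graph r G" "x \<in> weightings (verts G)" "verts G \<noteq> {}"
  shows "lagrangian_poly G x \<le> lagrangian G"
  using lagrangian_attained[OF assms(1,3)] assms(2) by blast

lemma r_graph_finite_edges: "r_graph r G \<Longrightarrow> finite (edges G)"
  unfolding r_graph_def using finite_imp_finite_nsets finite_subset by blast

lemma r_graph_edge_subset: "r_graph r G \<Longrightarrow> e \<in> edges G \<Longrightarrow> e \<subseteq> verts G"
  by (auto simp: r_graph_def nsets_def)

text \<open>
  An optimum weighting of a subgraph, extended by zero, is a weighting of the whole graph. If it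
  is an optimum there as well, then positivity forces the two vertex sets to agree, and no edge
  can be missing since each edge contributes a positive product.
\<close>

lemma dense_if_optimum_positive:
  assumes G: "r_graph r G" and pos: "0 < lagrangian G"
    and opt: "\<And>x i. x \<in> weightings (verts G) \<Longrightarrow> lagrangian_poly G x = lagrangian G \<Longrightarrow>
      i \<in> verts G \<Longrightarrow> 0 < x i"
  shows "dense_r_graph r G"
  unfolding dense_r_graph_def
proof (intro conjI allI impI G, elim conjE)
  fix H assume H: "r_graph r H" "subgraph H G" "H \<noteq> G"
  have ne: "verts G \<noteq> {}" using pos by (auto simp: lagrangian_def)
  have fin: "finite (verts G)" using G by (simp add: r_graph_def)
  have sub: "verts H \<subseteq> verts G" "edges H \<subseteq> edges G"
    using H by (auto simp: subgraph_def)
  show "lagrangian H < lagrangian G"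
  proof (cases "verts H = {}")
    case True
    then show ?thesis using pos by (simp add: lagrangian_def)
  next
    case False
    obtain x where x: "x \<in> weightings (verts H)" "lagrangian_poly H x = lagrangian H"
      using lagrangian_attained[OF H(1) False] by blast
    define z where "z i = (if i \<in> verts H then x i else 0)" for i
    have "sum z (verts G) = sum x (verts H)"
      using sub(1) fin by (simp add: z_def sum.If_cases Int_absorb1)
    then have z: "z \<in> weightings (verts G)"
      using x(1) by (auto simp: weightings_def z_def)
    have nonneg: "0 \<le> (\<Prod>i\<in>e. z i)" if "e \<in> edges G" for e
      using z r_graph_edge_subset[OF G that] by (auto simp: weightings_def intro!: prod_nonneg)
    have "lagrangian_poly H x = lagrangian_poly H z"
      unfolding lagrangian_poly_def z_def using r_graph_edge_subset[OF H(1)]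
      by (intro sum.cong prod.cong) auto
    then have Hz: "lagrangian H = lagrangian_poly H z" using x by simp
    have HG: "lagrangian_poly H z \<le> lagrangian_poly G z"
      unfolding lagrangian_poly_def using sub nonneg r_graph_finite_edges[OF G]
      by (intro sum_mono2) auto
    have zG: "lagrangian_poly G z \<le> lagrangian G"
      by (rule lagrangian_poly_le_lagrangian[OF G z ne])
    show ?thesis
    proof (rule ccontr)
      assume "\<not> ?thesis"
      then have eq: "lagrangian_poly G z = lagrangian G" "lagrangian_poly H z = lagrangian_poly G z"
        using Hz HG zG by auto
      have zpos: "0 < z i" if "i \<in> verts G" for i
        using opt[OF z eq(1) that] .
      then have "verts G \<subseteq> verts H"
        by (metis less_irrefl subsetI z_def)
      then have "verts H = verts G" using sub(1) by blast
      then obtain e where e: "e \<in> edges G - edges H"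
        using sub(2) H(3) by (metis hypergraph.expand psubsetI psubset_imp_ex_mem)
      have "0 < (\<Prod>i\<in>e. z i)"
        using e zpos r_graph_edge_subset[OF G] by (intro prod_pos) blast
      then have "lagrangian_poly H z < lagrangian_poly G z"
        unfolding lagrangian_poly_def using sub nonneg r_graph_finite_edges[OF G] e
        by (intro sum_strict_mono2) auto
      then show False using eq by simp
    qed
  qed
qed

text \<open>With a vertex of weight zero, only the edges in the other vertices contribute.\<close>

lemma lagrangian_poly_le_if_zero:
  assumes G: "r_graph r G" and x: "x \<in> weightings (verts G)"
    and i: "i \<in> verts G" "x i = 0"
  shows "lagrangian_poly G x
    \<le> ((card (verts G) - 1) choose r) * (1 / real (card (verts G) - 1)) ^ r"
proof -
  define V where "V = verts G - {i}"
  have fin: "finite (verts G)" "finite V" using G by (auto simp: r_graph_def V_def)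
  have nonneg: "\<forall>i\<in>V. 0 \<le> x i" using x by (auto simp: weightings_def V_def)
  have "lagrangian_poly G x = (\<Sum>e\<in>edges G \<inter> [V]\<^bsup>r\<^esup>. \<Prod>i\<in>e. x i)"
    unfolding lagrangian_poly_def
  proof (rule sum.mono_neutral_right)
    show "\<forall>e\<in>edges G - edges G \<inter> [V]\<^bsup>r\<^esup>. (\<Prod>i\<in>e. x i) = 0"
    proof
      fix e assume e: "e \<in> edges G - edges G \<inter> [V]\<^bsup>r\<^esup>"
      then have "i \<in> e" "finite e"
        using G by (auto simp: r_graph_def nsets_def V_def)
      then show "(\<Prod>i\<in>e. x i) = 0" using i(2) by (auto simp: prod_zero_iff)
    qed
  qed (use r_graph_finite_edges[OF G] in auto)
  also have "\<dots> \<le> lagrangian_poly (complete_r_graph r V) x"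
    unfolding lagrangian_poly_def complete_r_graph_def using fin nonneg
    by (auto simp: nsets_def finite_imp_finite_nsets[unfolded nsets_def] intro!: sum_mono2 prod_nonneg)
  also have "\<dots> \<le> (card V choose r) * (sum x V / card V) ^ r"
    by (rule maclaurin_complete[OF fin(2) nonneg])
  also have "sum x V = 1"
    using x i fin by (simp add: V_def weightings_def sum.remove[of "verts G" i])
  also have "card V = card (verts G) - 1"
    using i fin by (simp add: V_def)
  finally show ?thesis .
qed

section \<open>Exceeding the complete graph\<close>

text \<open>
  With weight \<open>\<epsilon>\<close> on the new vertex, weight \<open>(1 - \<epsilon>) / n\<close> on each of the \<open>n\<close> old ones and
  \<open>C = n choose (k + 1)\<close>, the right-hand side below is a lower bound for \<open>n ^ (k + 1)\<close> times the
  value of the weighting. Its linear terms in \<open>\<epsilon>\<close> are \<open>\<epsilon> * n\<close>, because those with factor \<open>C\<close>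
  cancel; the term \<open>\<epsilon> * n\<close> is the contribution of the one edge at the new vertex in excess of
  the degree of an old vertex.
\<close>

lemma exists_small_gain:
  fixes C n :: real and k :: nat
  assumes "0 \<le> C" "0 < n"
  shows "\<exists>\<epsilon>::real. 0 < \<epsilon> \<and> \<epsilon> < 1 \<and> C < (1 - \<epsilon>) ^ k * (C * (1 + k * \<epsilon>) + \<epsilon> * n)"
proof -
  \<comment> \<open>After Bernoulli's inequality, \<open>\<epsilon> * (k * n + C * k\<^sup>2) < n\<close> is what has to hold; the extra
      \<open>2 * n\<close> in the denominator gives this strictly, and \<open>\<epsilon> < 1\<close> as well.\<close>
  define D where "D = 2 * n + k * n + C * k\<^sup>2"
  define \<epsilon> where "\<epsilon> = n / D"
  have kn: "0 \<le> k * n" "0 \<le> C * k\<^sup>2"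
    using assms by simp_all
  then have D: "0 < D" "n < D"
    unfolding D_def using assms by linarith+
  then have \<epsilon>: "0 < \<epsilon>" "\<epsilon> < 1" "\<epsilon> * D = n"
    using assms by (simp_all add: \<epsilon>_def)
  have "0 < \<epsilon> * (2 * n)" using \<epsilon> assms by simp
  also have "\<epsilon> * (2 * n) = n - \<epsilon> * (k * n + C * k\<^sup>2)"
    using \<epsilon>(3) by (simp add: D_def algebra_simps)
  finally have "0 < \<epsilon> * (n - \<epsilon> * (k * n + C * k\<^sup>2))"
    using \<epsilon> by simp
  then have "C < (1 - k * \<epsilon>) * (C * (1 + k * \<epsilon>) + \<epsilon> * n)"
    by (simp add: algebra_simps power2_eq_square)
  also have "\<dots> \<le> (1 - \<epsilon>) ^ k * (C * (1 + k * \<epsilon>) + \<epsilon> * n)"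
  proof (rule mult_right_mono)
    show "1 - k * \<epsilon> \<le> (1 - \<epsilon>) ^ k"
      using Bernoulli_inequality[of "- \<epsilon>" k] \<epsilon>(2) by simp
    have "0 \<le> C * (1 + k * \<epsilon>)" "0 \<le> \<epsilon> * n"
      using \<epsilon>(1) assms by simp_all
    then show "0 \<le> C * (1 + k * \<epsilon>) + \<epsilon> * n" by linarith
  qed
  finally show ?thesis using \<epsilon> by blast
qed

text \<open>
  The degree condition enters through \<open>n * ((n - 1) choose k) = (k + 1) * (n choose (k + 1))\<close>,
  which expresses the degree of an old vertex in the complete graph by the number of its edges.
\<close>

lemma lagrangian_gt_complete:
  assumes G: "r_graph (Suc k) G" and a: "a \<in> verts G"
    and n: "card (verts G) = Suc n" "0 < n"
    and complete: "[verts G - {a}]\<^bsup>Suc k\<^esup> \<subseteq> edges G"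
    and many: "(n choose Suc k) + ((n - 1) choose k) < card (edges G)"
  shows "(n choose Suc k) * (1 / n) ^ Suc k < lagrangian G"
proof -
  define V where "V = verts G - {a}"
  define C where "C = real (n choose Suc k)"
  define S where "S = edges G - [V]\<^bsup>Suc k\<^esup>"
  obtain \<epsilon> :: real where \<epsilon>: "0 < \<epsilon>" "\<epsilon> < 1" "C < (1 - \<epsilon>) ^ k * (C * (1 + k * \<epsilon>) + \<epsilon> * n)"
    using exists_small_gain[of C n k] n by (auto simp: C_def)
  define p where "p = (1 - \<epsilon>) / n"
  define z where "z i = (if i = a then \<epsilon> else p)" for i
  have p: "0 \<le> p" "p * n = 1 - \<epsilon>" using \<epsilon> n by (auto simp: p_def)
  have fin: "finite (verts G)" "finite V" using G by (auto simp: r_graph_def V_def)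
  have card: "card V = n" using n a fin by (simp add: V_def)
  have "sum z (verts G) = \<epsilon> + sum z V"
    using a fin by (simp add: V_def z_def sum.remove)
  also have "sum z V = n * p"
    by (simp add: V_def z_def flip: card)
  finally have "z \<in> weightings (verts G)"
    using p \<epsilon> by (auto simp: weightings_def z_def mult.commute)
  then have le: "lagrangian_poly G z \<le> lagrangian G"
    using a by (intro lagrangian_poly_le_lagrangian[OF G]) auto
  have V: "(\<Prod>i\<in>e. z i) = p ^ Suc k" if "e \<in> [V]\<^bsup>Suc k\<^esup>" for e
  proof -
    have "(\<Prod>i\<in>e. z i) = (\<Prod>i\<in>e. p)"
      using that by (intro prod.cong) (auto simp: nsets_def V_def z_def)
    then show ?thesis using that by (simp add: nsets_def)
  qed
  have S: "(\<Prod>i\<in>e. z i) = \<epsilon> * p ^ k" if "e \<in> S" for e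
  proof -
    have e: "a \<in> e" "finite e" "card e = Suc k"
      using that G by (auto simp: S_def V_def r_graph_def nsets_def)
    have "(\<Prod>i\<in>e. z i) = \<epsilon> * (\<Prod>i\<in>e - {a}. z i)"
      using e by (simp add: prod.remove z_def)
    also have "(\<Prod>i\<in>e - {a}. z i) = (\<Prod>i\<in>e - {a}. p)"
      by (intro prod.cong) (auto simp: z_def)
    finally show ?thesis using e by simp
  qed
  have edges: "edges G = [V]\<^bsup>Suc k\<^esup> \<union> S"
    using complete by (auto simp: S_def V_def)
  have finS: "finite S" using r_graph_finite_edges[OF G] by (simp add: S_def)
  have disj: "[V]\<^bsup>Suc k\<^esup> \<inter> S = {}" by (auto simp: S_def)
  have "card (edges G) = (n choose Suc k) + card S"
    unfolding edges using disj finS fin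
    by (simp add: card_Un_disjoint finite_imp_finite_nsets card_nsets card)
  then have "Suc ((n - 1) choose k) \<le> card S" using many by simp
  then have "real ((n - 1) choose k) + 1 \<le> card S"
    by (metis of_nat_Suc of_nat_le_iff add.commute)
  then have "n * (real ((n - 1) choose k) + 1) \<le> n * real (card S)"
    by (intro mult_left_mono) simp_all
  moreover have "real n * real ((n - 1) choose k) = Suc k * C"
    using n(2) binomial_absorption[of k "n - 1"] unfolding C_def
    by (metis Suc_diff_1 binomial_absorption of_nat_mult)
  ultimately have deg: "Suc k * C + n \<le> n * card S"
    by (simp add: distrib_left)
  have "lagrangian_poly G z = C * p ^ Suc k + card S * (\<epsilon> * p ^ k)"
    unfolding lagrangian_poly_def edges using disj finS fin
    by (simp add: sum.union_disjoint finite_imp_finite_nsets V S card_nsets card C_def del: power_Suc)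
  then have "lagrangian_poly G z * n ^ Suc k
      = C * (p * n) ^ Suc k + \<epsilon> * (n * card S) * (p * n) ^ k"
    by (simp add: power_mult_distrib algebra_simps)
  also have "\<dots> = (1 - \<epsilon>) ^ k * (C * (1 - \<epsilon>) + \<epsilon> * (n * card S))"
    by (simp add: p algebra_simps)
  finally have scaled: "lagrangian_poly G z * n ^ Suc k
      = (1 - \<epsilon>) ^ k * (C * (1 - \<epsilon>) + \<epsilon> * (n * card S))" .
  note \<epsilon>(3)
  also have "(1 - \<epsilon>) ^ k * (C * (1 + k * \<epsilon>) + \<epsilon> * n)
      = (1 - \<epsilon>) ^ k * (C * (1 - \<epsilon>) + \<epsilon> * (Suc k * C + n))"
    by (simp add: algebra_simps)
  also have "\<dots> \<le> lagrangian_poly G z * n ^ Suc k"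
    unfolding scaled using \<epsilon> deg by (intro mult_left_mono add_left_mono) auto
  finally have "C / n ^ Suc k < lagrangian_poly G z"
    using n(2) by (simp add: divide_less_eq del: power_Suc)
  then show ?thesis
    using le by (simp add: C_def power_one_over del: power_Suc)
qed

section \<open>Density\<close>

theorem theorem3p2:
  fixes m t r :: nat and G :: "nat hypergraph"
  assumes "m > 0" and "t > 0" and "r \<ge> 3"
    and "m \<ge> ((t - 1) choose r) + ((t - 2) choose (r - 1)) + 1"
    and "r_graph r G" and "verts G = {1..t}" and "card (edges G) = m"
    and "subgraph (complete_r_graph r {1..t - 1}) G"
  shows "dense_r_graph r G"
proof -
  obtain k where r: "r = Suc k" using assms(3) by (cases r) auto
  obtain n where t: "t = Suc n" using assms(2) by (cases t) auto
  obtain e where "e \<in> edges G"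
    using assms(1,7) by fastforce
  then have "e \<subseteq> {1..t}" "card e = r"
    using assms(5,6) by (auto simp: r_graph_def nsets_def)
  then have "r \<le> t"
    using card_mono[of "{1..t}" e] by simp
  then have n: "0 < n" using assms(3) t by simp
  have "verts G - {t} = {1..t - 1}"
    unfolding assms(6) t by (simp add: atLeastAtMostSuc_conv)
  then have "[verts G - {t}]\<^bsup>Suc k\<^esup> \<subseteq> edges G"
    using assms(8) r by (simp add: subgraph_def complete_r_graph_def)
  then have gt: "(n choose r) * (1 / n) ^ r < lagrangian G"
    using assms n unfolding r t
    by (intro lagrangian_gt_complete[where a = "Suc n"]) auto
  show ?thesis
  proof (rule dense_if_optimum_positive[OF assms(5)])
    show "0 < lagrangian G"
      by (rule le_less_trans[OF _ gt]) simp
    fix x i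
    assume x: "x \<in> weightings (verts G)" "lagrangian_poly G x = lagrangian G" "i \<in> verts G"
    have "x i \<noteq> 0"
    proof
      assume "x i = 0"
      from lagrangian_poly_le_if_zero[OF assms(5) x(1,3) this] have
        "lagrangian_poly G x \<le> (n choose r) * (1 / n) ^ r"
        unfolding assms(6) t by simp
      then show False using gt x(2) by linarith
    qed
    moreover have "0 \<le> x i" using x(1,3) by (simp add: weightings_def)
    ultimately show "0 < x i" by linarith
  qed
qed

end
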